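(* Let $I\subseteq\overline{\mathbb R}[x_1,\dots,x_n]$ be a tropical ideal. For any $a\in\overline{\mathbb R}$, the ideal $I|_{x_n=a}:=\{f(x_1,\dots,x_{n-1},a):f\in I\}\subseteq\overline{\mathbb R}[x_1,\dots,x_{n-1}]$ is also a tropical ideal.
   Context: $\overline{\mathbb R}=(\mathbb R\cup\{\infty\},\oplus,\odot)$ with $a\oplus b=\min(a,b)$, $a\odot b=a+b$ (so $\infty$ is the additive identity and $0$ the multiplicative identity; substituting $a=\infty$ kills all terms involving $x_n$). For a polynomial $f$, $[f]_{\mathbf x^{\mathbf u}}$ denotes the coefficient of the monomial $\mathbf x^{\mathbf u}$. An ideal $I$ is a tropical ideal if for all $f,g\in I$ and every monomial $\mathbf x^{\mathbf u}$ with $[f]_{\mathbf x^{\mathbf u}}=[g]_{\mathbf x^{\mathbf u}}\neq\infty$ there exists $h\in I$ with $[h]_{\mathbf x^{\mathbf u}}=\infty$ and $[h]_{\mathbf x^{\mathbf v}}\ge\min([f]_{\mathbf x^{\mathbf v}},[g]_{\mathbf x^{\mathbf v}})$ for all monomials $\mathbf x^{\mathbf v}$, with equality whenever $[f]_{\mathbf x^{\mathbf v}}\ne[g]_{\mathbf x^{\mathbf v}}$. *)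

theory Defs
  imports Complex_Main
begin

datatype trop = Fin real | Infty

instantiation trop :: linorder
begin
fun less_eq_trop :: "trop \<Rightarrow> trop \<Rightarrow> bool" where
  "less_eq_trop (Fin x) (Fin y) = (x \<le> y)"
| "less_eq_trop _ Infty = True"
| "less_eq_trop Infty (Fin _) = False"
definition less_trop :: "trop \<Rightarrow> trop \<Rightarrow> bool" where
  "less_trop a b = (a \<le> b \<and> \<not> b \<le> a)"
instance
proof
  fix x y z :: trop
  show "(x < y) = (x \<le> y \<and> \<not> y \<le> x)" by (simp add: less_trop_def)
  show "x \<le> x" by (cases x) auto
  show "x \<le> y \<Longrightarrow> y \<le> z \<Longrightarrow> x \<le> z" by (cases x; cases y; cases z) auto
  show "x \<le> y \<Longrightarrow> y \<le> x \<Longrightarrow> x = y" by (cases x; cases y) auto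
  show "x \<le> y \<or> y \<le> x" by (cases x; cases y) auto
qed
end

instantiation trop :: comm_monoid_add
begin
definition zero_trop :: trop where "zero_trop = Infty"
definition plus_trop :: "trop \<Rightarrow> trop \<Rightarrow> trop" where "plus_trop a b = min a b"
instance
proof
  fix a b c :: trop
  show "a + b + c = a + (b + c)" by (simp add: plus_trop_def min.assoc)
  show "a + b = b + a" by (simp add: plus_trop_def min.commute)
  show "0 + a = a" by (cases a) (auto simp: plus_trop_def zero_trop_def min_def)
qed
end

fun tmul :: "trop \<Rightarrow> trop \<Rightarrow> trop" where
  "tmul (Fin x) (Fin y) = Fin (x + y)"
| "tmul _ _ = Infty"

text \<open>Tropical power a^{\<odot>k}; a^{\<odot>0} = 0 (the tropical one) also for a = Infty.\<close>
fun tpow :: "trop \<Rightarrow> nat \<Rightarrow> trop" where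
  "tpow a 0 = Fin 0"
| "tpow (Fin x) k = Fin (real k * x)"
| "tpow Infty (Suc _) = Infty"

text \<open>A tropical polynomial in n variables x_1..x_n: a map from exponent vectors
  (lists of length n) to coefficients, with finite support; coefficient Infty means
  the monomial is absent.\<close>
type_synonym tpoly = "nat list \<Rightarrow> trop"

definition is_tpoly :: "nat \<Rightarrow> tpoly \<Rightarrow> bool" where
  "is_tpoly n f \<longleftrightarrow> finite {u. f u \<noteq> Infty} \<and> (\<forall>u. f u \<noteq> Infty \<longrightarrow> length u = n)"

definition padd :: "tpoly \<Rightarrow> tpoly \<Rightarrow> tpoly" where
  "padd f g = (\<lambda>u. f u + g u)"

definition pmul :: "tpoly \<Rightarrow> tpoly \<Rightarrow> tpoly" where
  "pmul f g = (\<lambda>w. \<Sum>(u, v) \<in> {(u, v). length u = length w \<and> length v = length w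
        \<and> map2 (+) u v = w \<and> f u \<noteq> Infty \<and> g v \<noteq> Infty}. tmul (f u) (g v))"

definition tideal :: "nat \<Rightarrow> tpoly set \<Rightarrow> bool" where
  "tideal n I \<longleftrightarrow> I \<subseteq> {f. is_tpoly n f} \<and> (\<lambda>_. Infty) \<in> I
     \<and> (\<forall>f\<in>I. \<forall>g\<in>I. padd f g \<in> I)
     \<and> (\<forall>f\<in>I. \<forall>h. is_tpoly n h \<longrightarrow> pmul h f \<in> I)"

definition tropical_ideal :: "nat \<Rightarrow> tpoly set \<Rightarrow> bool" where
  "tropical_ideal n I \<longleftrightarrow> tideal n I \<and>
     (\<forall>f\<in>I. \<forall>g\<in>I. \<forall>u. f u = g u \<and> f u \<noteq> Infty \<longrightarrow>
        (\<exists>h\<in>I. h u = Infty \<and>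
           (\<forall>v. h v \<ge> min (f v) (g v) \<and> (f v \<noteq> g v \<longrightarrow> h v = min (f v) (g v)))))"

definition subst_last :: "trop \<Rightarrow> tpoly \<Rightarrow> tpoly" where
  "subst_last a f = (\<lambda>w. \<Sum>k \<in> {k. f (w @ [k]) \<noteq> Infty}. tmul (f (w @ [k])) (tpow a k))"

end

theory Submission
  imports Defs "HOL-Library.Product_Lexorder"
begin

text \<open>For \<open>a = \<infinity>\<close> substitution restricts coefficient vectors to the monomials free of the last
  variable \<open>x\<close>, which preserves the elimination axiom. For finite \<open>a\<close>, rescale \<open>x\<close> so that
  substitution takes the minimum of each fiber of coefficients over a fixed monomial in the other
  variables. Let \<open>F\<close> and \<open>G\<close> be the fiber minima of \<open>f\<close> and \<open>g\<close>, and let \<open>F u = G u\<close>; since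
  polynomials can be added, it suffices to eliminate \<open>u\<close> while preserving one coordinate \<open>v\<close> with
  \<open>F v < G v\<close>. If \<open>f\<close> and \<open>g\<close> have degree at most \<open>D\<close> in \<open>x\<close> over \<open>u\<close>, then the \<open>2 D + 2\<close>
  products of \<open>f\<close> and \<open>g\<close> with \<open>x\<^sup>0, \<dots>, x\<^sup>D\<close> involve only \<open>2 D + 1\<close> monomials over \<open>u\<close>, and they are
  in echelon form with respect to the lowest monomials over \<open>v\<close> (for \<open>f\<close>) and over \<open>u\<close> (for \<open>g\<close>)
  at which the minimum is attained. Valuated Gaussian elimination leaves one polynomial that has no
  monomial over \<open>u\<close> and still attains the minimum at its pivot, which must therefore lie over \<open>v\<close>.\<close>

section \<open>Tropical arithmetic\<close>

lemma le_Infty [simp]: "x \<le> Infty"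
  by (cases x) auto

lemma Infty_le_iff [simp]: "Infty \<le> x \<longleftrightarrow> x = Infty"
  by (cases x) auto

lemma less_Infty_iff [simp]: "x < Infty \<longleftrightarrow> x \<noteq> Infty"
  by (cases x) (auto simp: less_trop_def)

lemma not_Infty_less [simp]: "\<not> Infty < x"
  by (simp add: not_less)

lemma Fin_less_Fin [simp]: "Fin x < Fin y \<longleftrightarrow> x < y"
  by (auto simp: less_trop_def)

interpretation tmul: comm_monoid tmul "Fin 0"
proof
  show "tmul (tmul x y) z = tmul x (tmul y z)" for x y z
    by (cases x; cases y; cases z) auto
  show "tmul x y = tmul y x" for x y
    by (cases x; cases y) auto
  show "tmul x (Fin 0) = x" for x
    by (cases x) auto
qed

lemma tmul_Infty [simp]: "tmul x Infty = Infty" "tmul Infty x = Infty"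
  by (cases x; simp)+

lemma tmul_eq_Infty_iff [simp]: "tmul x y = Infty \<longleftrightarrow> x = Infty \<or> y = Infty"
  by (cases x; cases y) auto

lemma tmul_add_right: "tmul x (y + z) = tmul x y + tmul x z"
  by (cases x; cases y; cases z) (auto simp: plus_trop_def min_def)

lemma tmul_Fin_cancel [simp]:
  "tmul (Fin c) x \<le> tmul (Fin c) y \<longleftrightarrow> x \<le> y"
  "tmul (Fin c) x = tmul (Fin c) y \<longleftrightarrow> x = y"
  by (cases x; cases y; simp)+

lemma le_tmul_Fin_iff: "y \<le> tmul (Fin c) x \<longleftrightarrow> tmul (Fin (- c)) y \<le> x"
  by (cases x; cases y) auto

lemma le_tmul_Fin_nonneg: "0 \<le> c \<Longrightarrow> x \<le> tmul (Fin c) x"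
  by (cases x) auto

lemma less_tmul_Fin_pos: "0 < c \<Longrightarrow> x \<noteq> Infty \<Longrightarrow> x < tmul (Fin c) x"
  by (cases x) auto

lemma le_imp_eq_tmul_Fin:
  assumes "x \<le> y" "y \<noteq> Infty"
  obtains c where "0 \<le> c" "y = tmul (Fin c) x" "0 < c \<longleftrightarrow> x < y"
proof -
  obtain r s where "x = Fin r" "y = Fin s"
    using assms by (cases x; cases y) auto
  with assms that[of "s - r"] show thesis by simp
qed

lemma tpow_Fin [simp]: "tpow (Fin x) k = Fin (real k * x)"
  by (cases k) auto

lemma le_plus_trop_iff [simp]: "(c :: trop) \<le> a + b \<longleftrightarrow> c \<le> a \<and> c \<le> b"
  by (simp add: plus_trop_def)

lemma le_sum_trop_iff:
  fixes c :: trop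
  assumes "finite A"
  shows "c \<le> sum f A \<longleftrightarrow> (\<forall>x\<in>A. c \<le> f x)"
  using assms by induction (auto simp: zero_trop_def)

lemma tmul_sum_right:
  assumes "finite A"
  shows "tmul x (sum f A) = (\<Sum>y\<in>A. tmul x (f y))"
  using assms by induction (auto simp: zero_trop_def tmul_add_right)

lemma eqI_lower_bounds:
  fixes x y :: "'a :: order"
  shows "(\<And>c. c \<le> x \<longleftrightarrow> c \<le> y) \<Longrightarrow> x = y"
  by (meson order.antisym order.refl)

section \<open>Tropical linear spaces\<close>

definition supp :: "('e \<Rightarrow> trop) \<Rightarrow> 'e set" where
  "supp f = {x. f x \<noteq> Infty}"

definition tsubmodule :: "('e \<Rightarrow> trop) set \<Rightarrow> bool" where
  "tsubmodule L \<longleftrightarrow> (\<lambda>_. Infty) \<in> L \<and> (\<forall>f\<in>L. \<forall>g\<in>L. (\<lambda>x. f x + g x) \<in> L) \<and>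
     (\<forall>f\<in>L. \<forall>c. (\<lambda>x. tmul c (f x)) \<in> L)"

definition eliminates ::
    "'e set \<Rightarrow> 'e \<Rightarrow> ('e \<Rightarrow> trop) \<Rightarrow> ('e \<Rightarrow> trop) \<Rightarrow> ('e \<Rightarrow> trop) \<Rightarrow> bool" where
  "eliminates V u f g h \<longleftrightarrow> h u = Infty \<and> (\<forall>x. min (f x) (g x) \<le> h x) \<and>
     (\<forall>v\<in>V. h v = min (f v) (g v))"

lemma eliminates_differing_iff:
  "eliminates {v. f v \<noteq> g v} u f g h \<longleftrightarrow> h u = Infty \<and>
     (\<forall>v. min (f v) (g v) \<le> h v \<and> (f v \<noteq> g v \<longrightarrow> h v = min (f v) (g v)))"
  by (auto simp: eliminates_def)

definition tropical_linear_space :: "('e \<Rightarrow> trop) set \<Rightarrow> bool" where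
  "tropical_linear_space L \<longleftrightarrow> tsubmodule L \<and>
     (\<forall>f\<in>L. \<forall>g\<in>L. \<forall>u. f u = g u \<and> f u \<noteq> Infty \<longrightarrow>
        (\<exists>h\<in>L. eliminates {v. f v \<noteq> g v} u f g h))"

lemma tropical_linear_spaceE:
  assumes "tropical_linear_space L" "f \<in> L" "g \<in> L" "f u = g u" "f u \<noteq> Infty"
  obtains h where "h \<in> L" "eliminates {v. f v \<noteq> g v} u f g h"
  using assms unfolding tropical_linear_space_def by blast

lemma tropical_linear_space_scale:
  "tropical_linear_space L \<Longrightarrow> f \<in> L \<Longrightarrow> (\<lambda>x. tmul c (f x)) \<in> L"
  by (simp add: tropical_linear_space_def tsubmodule_def)

lemma tsubmodule_image:
  assumes L: "tsubmodule L"
    and add: "\<And>f g. f \<in> L \<Longrightarrow> g \<in> L \<Longrightarrow> T (\<lambda>x. f x + g x) = (\<lambda>y. T f y + T g y)"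
    and scale: "\<And>c f. f \<in> L \<Longrightarrow> T (\<lambda>x. tmul c (f x)) = (\<lambda>y. tmul c (T f y))"
  shows "tsubmodule (T ` L)"
proof -
  have "T (\<lambda>_. Infty) = (\<lambda>_. Infty)"
    using scale[of "\<lambda>_. Infty" Infty] L by (simp add: tsubmodule_def)
  then have "(\<lambda>_. Infty) \<in> T ` L"
    using L by (metis image_eqI tsubmodule_def)
  moreover have "(\<lambda>y. T f y + T g y) \<in> T ` L" if "f \<in> L" "g \<in> L" for f g
    using L that add[OF that] by (metis image_eqI tsubmodule_def)
  moreover have "(\<lambda>y. tmul c (T f y)) \<in> T ` L" if "f \<in> L" for f c
    using L that scale[OF that] by (metis image_eqI tsubmodule_def)
  ultimately show ?thesis by (auto simp: tsubmodule_def)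
qed

lemma eliminates_commute: "eliminates V u g f h \<longleftrightarrow> eliminates V u f g h"
  by (simp add: eliminates_def min.commute)

lemma eliminates_Un:
  assumes "eliminates V u f g h" "eliminates W u f g k"
  shows "eliminates (V \<union> W) u f g (\<lambda>x. h x + k x)"
  unfolding eliminates_def
proof (intro conjI allI ballI)
  show "h u + k u = Infty"
    using assms by (simp add: eliminates_def plus_trop_def)
  show ge: "min (f x) (g x) \<le> h x + k x" for x
    using assms by (simp add: eliminates_def)
  show "h v + k v = min (f v) (g v)" if "v \<in> V \<union> W" for v
  proof (rule order.antisym[OF _ ge])
    show "h v + k v \<le> min (f v) (g v)"
      using assms that unfolding eliminates_def plus_trop_def
      by (metis UnE min.cobounded1 min.cobounded2)
  qed
qed

lemma tropical_linear_spaceI: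
  assumes L: "tsubmodule L" and finite: "\<And>f. f \<in> L \<Longrightarrow> finite (supp f)"
    and elim: "\<And>f g u v. \<lbrakk>f \<in> L; g \<in> L; f u = g u; f u \<noteq> Infty; f v < g v\<rbrakk> \<Longrightarrow>
      \<exists>h\<in>L. eliminates {v} u f g h"
  shows "tropical_linear_space L"
  unfolding tropical_linear_space_def
proof (intro conjI ballI allI impI; (elim conjE)?)
  fix f g u assume f: "f \<in> L" and g: "g \<in> L" and u: "f u = g u" "f u \<noteq> Infty"
  have single: "\<exists>h\<in>L. eliminates {v} u f g h" if "f v \<noteq> g v" for v
    using that
  proof (cases "f v" "g v" rule: linorder_cases)
    case greater
    then show ?thesis
      using elim[OF g f, of u v] u by (simp add: eliminates_commute)
  qed (use elim f g u in auto)
  have "\<exists>h\<in>L. eliminates V u f g h" if "finite V" "V \<subseteq> {v. f v \<noteq> g v}" for V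
    using that
  proof induction
    case empty
    then show ?case using L by (auto simp: tsubmodule_def eliminates_def)
  next
    case (insert v V)
    then obtain h k where "h \<in> L" "k \<in> L" "eliminates {v} u f g h" "eliminates V u f g k"
      using single[of v] by auto
    then show ?case
      using L eliminates_Un[of "{v}" u f g h V k] by (auto simp: tsubmodule_def)
  qed
  moreover have "{v. f v \<noteq> g v} \<subseteq> supp f \<union> supp g"
    by (auto simp: supp_def)
  then have "finite {v. f v \<noteq> g v}"
    using finite f g by (auto intro: finite_subset)
  ultimately show "\<exists>h\<in>L. eliminates {v. f v \<noteq> g v} u f g h" by blast
qed (rule L)

lemma tropical_linear_space_vanishing:
  assumes "tropical_linear_space L"
  shows "tropical_linear_space {f \<in> L. \<forall>x\<in>X. f x = Infty}"
  unfolding tropical_linear_space_def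
proof (intro conjI ballI allI impI; (elim conjE)?)
  show "tsubmodule {f \<in> L. \<forall>x\<in>X. f x = Infty}"
    using assms by (auto simp: tropical_linear_space_def tsubmodule_def plus_trop_def)
  fix f g u
  assume f: "f \<in> {f \<in> L. \<forall>x\<in>X. f x = Infty}" and g: "g \<in> {f \<in> L. \<forall>x\<in>X. f x = Infty}"
    and u: "f u = g u" "f u \<noteq> Infty"
  then obtain h where h: "h \<in> L" "eliminates {v. f v \<noteq> g v} u f g h"
    using tropical_linear_spaceE[OF assms, of f g u] by blast
  then have "min (f x) (g x) \<le> h x" for x by (simp add: eliminates_def)
  then have "h x = Infty" if "x \<in> X" for x
    using f g that by (metis (mono_tags) Infty_le_iff mem_Collect_eq min.idem)
  with h show "\<exists>h\<in>{f \<in> L. \<forall>x\<in>X. f x = Infty}. eliminates {v. f v \<noteq> g v} u f g h"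
    by blast
qed

lemma tropical_linear_space_reweight:
  assumes L: "tropical_linear_space L"
  shows "tropical_linear_space ((\<lambda>f x. tmul (Fin (c x)) (f (\<phi> x))) ` L)"
    (is "tropical_linear_space (?T ` L)")
  unfolding tropical_linear_space_def
proof (intro conjI ballI allI impI; (elim conjE)?)
  show "tsubmodule (?T ` L)"
    using L by (intro tsubmodule_image)
      (auto simp: tropical_linear_space_def tmul_add_right tmul.left_commute)
  fix F G u assume "F \<in> ?T ` L" "G \<in> ?T ` L" and u: "F u = G u" "F u \<noteq> Infty"
  then obtain f g where f: "f \<in> L" "F = ?T f" and g: "g \<in> L" "G = ?T g" by blast
  then obtain h where "h \<in> L" "eliminates {v. f v \<noteq> g v} (\<phi> u) f g h"
    using u tropical_linear_spaceE[OF L, of f g "\<phi> u"] by auto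
  then have "eliminates {v. F v \<noteq> G v} u F G (?T h)"
    by (auto simp: eliminates_def f g tmul_add_right[unfolded plus_trop_def, symmetric])
  with \<open>h \<in> L\<close> show "\<exists>H\<in>?T ` L. eliminates {v. F v \<noteq> G v} u F G H" by blast
qed

section \<open>Valuated Gaussian elimination\<close>

text \<open>Relative to the lower bound \<open>B\<close>, the coordinates where a vector attains \<open>B\<close> play the role
  of its support modulo the maximal ideal of a valuation ring.\<close>

definition echelon_row ::
    "('e \<Rightarrow> trop) \<Rightarrow> ('i :: linorder \<Rightarrow> 'e) \<Rightarrow> 'i set \<Rightarrow> 'i \<Rightarrow> ('e \<Rightarrow> trop) \<Rightarrow> bool" where
  "echelon_row B l J i f \<longleftrightarrow> (\<forall>x. B x \<le> f x) \<and> f (l i) = B (l i) \<and> B (l i) \<noteq> Infty \<and>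
     (\<forall>k\<in>J. k < i \<longrightarrow> B (l k) < f (l k))"

lemma echelon_row_scale_less:
  assumes f: "echelon_row B l J p f" and k: "k \<in> J - {p}" "B (l k) \<noteq> Infty"
    and c: "0 \<le> c" "p < k \<Longrightarrow> 0 < c"
  shows "B (l k) < tmul (Fin c) (f (l k))"
proof (cases "k < p")
  case True
  then have "B (l k) < f (l k)" using f k(1) by (simp add: echelon_row_def)
  then show ?thesis using le_tmul_Fin_nonneg[OF c(1)] by (rule less_le_trans)
next
  case False
  with k(1) c(2) have "0 < c" by auto
  have "B (l k) \<le> f (l k)" using f by (simp add: echelon_row_def)
  with k(2) \<open>0 < c\<close> show ?thesis
    using less_tmul_Fin_pos[of c "f (l k)"] by (cases "f (l k) = Infty") (auto intro: le_less_trans)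
qed

lemma echelon_row_eliminate:
  assumes L: "tropical_linear_space L" "f \<in> L" "g \<in> L"
    and f: "echelon_row B l J p f" and g: "echelon_row B l J i g"
    and i: "i \<in> J - {p}" and f_le_g: "f s \<le> g s" and f_less_g: "p < i \<Longrightarrow> f s < g s"
  obtains h where "h \<in> L" "h s = Infty" "echelon_row B l (J - {p}) i h"
proof (cases "g s = Infty")
  case True
  then show thesis using that[of g] L(3) g by (auto simp: echelon_row_def)
next
  case False
  with f_le_g obtain c where c: "0 \<le> c" "g s = tmul (Fin c) (f s)" "0 < c \<longleftrightarrow> f s < g s"
    by (rule le_imp_eq_tmul_Fin)
  define f' where "f' x = tmul (Fin c) (f x)" for x
  have "f' \<in> L" unfolding f'_def using L(1,2) by (rule tropical_linear_space_scale)
  then obtain h where h: "h \<in> L" "eliminates {v. g v \<noteq> f' v} s g f' h"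
    using tropical_linear_spaceE[OF L(1,3), of f' s] c(2) False by (auto simp: f'_def)
  have f'_ge: "B x \<le> f' x" for x
    using f le_tmul_Fin_nonneg[OF c(1), of "f x"] order.trans
    unfolding echelon_row_def f'_def by blast
  have f'_gt: "B (l k) < f' (l k)" if k: "k \<in> J - {p}" "k \<le> i" for k
    unfolding f'_def using f k(1)
  proof (rule echelon_row_scale_less)
    show "B (l k) \<noteq> Infty" using g k by (cases "k = i") (auto simp: echelon_row_def)
    show "0 < c" if "p < k" using that k(2) f_less_g c(3) by simp
  qed (rule c(1))
  have "echelon_row B l (J - {p}) i h"
    unfolding echelon_row_def
  proof (intro conjI allI ballI impI)
    show "B x \<le> h x" for x
      using h(2) f'_ge[of x] g unfolding echelon_row_def eliminates_def
      by (meson min.boundedI order.trans)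
    show "h (l i) = B (l i)"
      using h(2) f'_gt[of i] g i by (auto simp: eliminates_def echelon_row_def)
    show "B (l i) \<noteq> Infty" using g by (simp add: echelon_row_def)
    show "B (l k) < h (l k)" if "k \<in> J - {p}" "k < i" for k
      using h(2) f'_gt[of k] g that unfolding eliminates_def echelon_row_def
      by (metis DiffE less_le_trans min_less_iff_conj order_less_imp_le)
  qed
  with h show thesis using that by (auto simp: eliminates_def)
qed

lemma ex_last_minimum:
  fixes f :: "'i :: linorder \<Rightarrow> 'a :: linorder"
  assumes "finite J" "J \<noteq> {}"
  shows "\<exists>p\<in>J. \<forall>i\<in>J. f p \<le> f i \<and> (p < i \<longrightarrow> f p < f i)"
  using assms
proof (induction rule: finite_linorder_max_induct)
  case (insert b A)
  show ?case
  proof (cases "A = {}")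
    case False
    with insert.IH obtain p where p: "p \<in> A" "\<forall>i\<in>A. f p \<le> f i \<and> (p < i \<longrightarrow> f p < f i)"
      by blast
    show ?thesis
    proof (cases "f b \<le> f p")
      case True
      with p insert.hyps show ?thesis
        by (intro bexI[of _ b]) (auto intro: order.trans)
    next
      case False
      with p show ?thesis by (intro bexI[of _ p]) auto
    qed
  qed simp
qed simp

lemma echelon_eliminate:
  assumes "finite S" "finite J" "card S < card J" "tropical_linear_space L"
    and "\<And>i. i \<in> J \<Longrightarrow> w i \<in> L \<and> echelon_row B l J i (w i)"
  shows "\<exists>h\<in>L. (\<forall>s\<in>S. h s = Infty) \<and> (\<forall>x. B x \<le> h x) \<and> (\<exists>i\<in>J. h (l i) = B (l i))"
  using assms
proof (induction S arbitrary: J L w rule: finite_induct)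
  case empty
  then have "J \<noteq> {}" by auto
  with empty.prems(4) show ?case unfolding echelon_row_def by blast
next
  case (insert s S)
  then have "J \<noteq> {}" by auto
  \<comment> \<open>Among the vectors of least value at \<open>s\<close>, the last one is sacrificed: the scaling factors are
    then nonnegative, and positive for the rows after \<open>p\<close>, so that the pivots survive.\<close>
  then obtain p where p: "p \<in> J" "\<And>i. i \<in> J \<Longrightarrow> w p s \<le> w i s"
      "\<And>i. i \<in> J \<Longrightarrow> p < i \<Longrightarrow> w p s < w i s"
    using ex_last_minimum[OF insert.prems(1), of "\<lambda>i. w i s"] by blast
  have "\<exists>h. h \<in> L \<and> h s = Infty \<and> echelon_row B l (J - {p}) i h" if "i \<in> J - {p}" for i
    using that echelon_row_eliminate[of L "w p" "w i" B l J p i s] p insert.prems(3,4)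
    by (metis Diff_iff)
  then obtain w' where w': "\<And>i. i \<in> J - {p} \<Longrightarrow>
      w' i \<in> L \<and> w' i s = Infty \<and> echelon_row B l (J - {p}) i (w' i)"
    by metis
  let ?L = "{f \<in> L. \<forall>x\<in>{s}. f x = Infty}"
  have "\<exists>h\<in>?L. (\<forall>s\<in>S. h s = Infty) \<and> (\<forall>x. B x \<le> h x) \<and> (\<exists>i\<in>J - {p}. h (l i) = B (l i))"
  proof (rule insert.IH[where w = w'])
    show "card S < card (J - {p})"
      using insert.hyps insert.prems(1,2) p(1) by simp
    show "tropical_linear_space ?L"
      using insert.prems(3) by (rule tropical_linear_space_vanishing)
  qed (use insert.prems(1) w' in auto)
  then show ?case by auto
qed

section \<open>Minima over fibers\<close>

definition fiber_min :: "('e \<times> nat \<Rightarrow> trop) \<Rightarrow> 'e \<Rightarrow> trop" where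
  "fiber_min f e = Min (range (\<lambda>k. f (e, k)))"

lemma finite_fiber_values:
  assumes "finite (supp f)"
  shows "finite (range (\<lambda>k. f (e, k)))"
  by (rule finite_subset[of _ "insert Infty (f ` supp f)"]) (use assms in \<open>auto simp: supp_def\<close>)

lemma le_fiber_min_iff:
  assumes "finite (supp f)"
  shows "c \<le> fiber_min f e \<longleftrightarrow> (\<forall>k. c \<le> f (e, k))"
  unfolding fiber_min_def using finite_fiber_values[OF assms] by simp

lemma fiber_min_le:
  assumes "finite (supp f)"
  shows "fiber_min f e \<le> f (e, k)"
  using le_fiber_min_iff[OF assms] by blast

lemma finite_supp_fiber_min:
  assumes "finite (supp f)"
  shows "finite (supp (fiber_min f))"
proof (rule finite_subset)
  show "supp (fiber_min f) \<subseteq> fst ` supp f"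
    using le_fiber_min_iff[OF assms, of Infty] by (force simp: supp_def)
qed (use assms in simp)

lemma finite_supp_add:
  assumes "finite (supp f)" "finite (supp g)"
  shows "finite (supp (\<lambda>x. f x + g x))"
  by (rule finite_subset[of _ "supp f \<union> supp g"])
    (use assms in \<open>auto simp: supp_def plus_trop_def min_def\<close>)

lemma finite_supp_scale:
  assumes "finite (supp f)"
  shows "finite (supp (\<lambda>x. tmul c (f x)))"
  by (rule finite_subset[OF _ assms]) (auto simp: supp_def)

lemma fiber_min_add:
  assumes "finite (supp f)" "finite (supp g)"
  shows "fiber_min (\<lambda>x. f x + g x) = (\<lambda>e. fiber_min f e + fiber_min g e)"
  by (rule ext, rule eqI_lower_bounds)
    (auto simp: le_fiber_min_iff[OF finite_supp_add[OF assms]] le_fiber_min_iff assms)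

lemma fiber_min_scale:
  assumes "finite (supp f)"
  shows "fiber_min (\<lambda>x. tmul c (f x)) = (\<lambda>e. tmul c (fiber_min f e))"
proof (cases c)
  case (Fin r)
  show ?thesis
    by (rule ext, rule eqI_lower_bounds)
      (simp add: le_fiber_min_iff[OF finite_supp_scale[OF assms]] le_fiber_min_iff assms Fin
        le_tmul_Fin_iff)
qed (simp add: fiber_min_def fun_eq_iff)

definition least_minimizer :: "('e \<times> nat \<Rightarrow> trop) \<Rightarrow> 'e \<Rightarrow> nat" where
  "least_minimizer f e = (LEAST k. f (e, k) = fiber_min f e)"

lemma fiber_min_attained:
  assumes "finite (supp f)"
  shows "f (e, least_minimizer f e) = fiber_min f e"
  unfolding least_minimizer_def
proof (rule LeastI_ex)
  have "fiber_min f e \<in> range (\<lambda>k. f (e, k))"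
    unfolding fiber_min_def by (rule Min_in[OF finite_fiber_values[OF assms]]) simp
  then show "\<exists>k. f (e, k) = fiber_min f e" by auto
qed

lemma fiber_min_less:
  assumes "finite (supp f)" "k < least_minimizer f e"
  shows "fiber_min f e < f (e, k)"
  using fiber_min_le[OF assms(1), of e k] not_less_Least[OF assms(2)[unfolded least_minimizer_def]]
  by simp

definition shift :: "nat \<Rightarrow> ('e \<times> nat \<Rightarrow> trop) \<Rightarrow> 'e \<times> nat \<Rightarrow> trop" where
  "shift i f = (\<lambda>(e, k). if i \<le> k then f (e, k - i) else Infty)"

definition fiber_bound :: "('e \<times> nat \<Rightarrow> trop) \<Rightarrow> ('e \<times> nat \<Rightarrow> trop) \<Rightarrow> 'e \<times> nat \<Rightarrow> trop" where
  "fiber_bound f g = (\<lambda>(x, k). min (fiber_min f x) (fiber_min g x))"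

text \<open>In the lexicographic order the multiples of \<open>f\<close> precede those of \<open>g\<close>, which exceed the bound
  at every pivot over \<open>v\<close>.\<close>

definition shift_family ::
    "('e \<times> nat \<Rightarrow> trop) \<Rightarrow> ('e \<times> nat \<Rightarrow> trop) \<Rightarrow> bool \<times> nat \<Rightarrow> 'e \<times> nat \<Rightarrow> trop" where
  "shift_family f g = (\<lambda>(b, i). shift i (if b then g else f))"

definition shift_pivot ::
    "('e \<times> nat \<Rightarrow> trop) \<Rightarrow> ('e \<times> nat \<Rightarrow> trop) \<Rightarrow> 'e \<Rightarrow> 'e \<Rightarrow> bool \<times> nat \<Rightarrow> 'e \<times> nat" where
  "shift_pivot f g v u =
    (\<lambda>(b, i). if b then (u, least_minimizer g u + i) else (v, least_minimizer f v + i))"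

lemma echelon_row_shift_family:
  assumes fin: "finite (supp f)" "finite (supp g)"
    and u: "fiber_min f u = fiber_min g u" "fiber_min f u \<noteq> Infty"
    and v: "fiber_min f v < fiber_min g v"
  shows "echelon_row (fiber_bound f g) (shift_pivot f g v u) J j (shift_family f g j)"
  unfolding echelon_row_def
proof (intro conjI allI ballI impI)
  have bound: "fiber_bound f g (u, k) = fiber_min g u"
    "fiber_bound f g (v, k) = fiber_min f v" for k
    using u v by (auto simp: fiber_bound_def)
  show "fiber_bound f g x \<le> shift_family f g j x" for x
    using fiber_min_le[OF fin(1)] fiber_min_le[OF fin(2)]
    by (cases x; cases j) (auto simp: fiber_bound_def shift_family_def shift_def min_le_iff_disj)
  show "shift_family f g j (shift_pivot f g v u j) = fiber_bound f g (shift_pivot f g v u j)"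
    using fin by (cases j)
      (simp add: shift_pivot_def shift_family_def shift_def bound fiber_min_attained)
  show "fiber_bound f g (shift_pivot f g v u j) \<noteq> Infty"
    using u v by (cases j) (auto simp: shift_pivot_def bound)
  fix i assume "i < j"
  have "fiber_min f v < g (v, k)" for k
    using v fiber_min_le[OF fin(2)] by (rule less_le_trans)
  with \<open>i < j\<close>
  show "fiber_bound f g (shift_pivot f g v u i) < shift_family f g j (shift_pivot f g v u i)"
    using u v by (cases i; cases j)
      (auto simp: shift_pivot_def bound shift_family_def shift_def fin intro!: fiber_min_less)
qed

locale shift_closed_linear_space =
  fixes L :: "('e \<times> nat \<Rightarrow> trop) set"
  assumes linear_space: "tropical_linear_space L"
    and finite_supp: "f \<in> L \<Longrightarrow> finite (supp f)"
    and shift_closed: "f \<in> L \<Longrightarrow> shift i f \<in> L"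
begin

lemma eliminate_in_shift_family:
  assumes f: "f \<in> L" and g: "g \<in> L"
    and u: "fiber_min f u = fiber_min g u" "fiber_min f u \<noteq> Infty"
    and v: "fiber_min f v < fiber_min g v"
  obtains h j where "h \<in> L" "\<And>k. h (u, k) = Infty" "\<And>x. fiber_bound f g x \<le> h x"
    "h (shift_pivot f g v u j) = fiber_bound f g (shift_pivot f g v u j)"
proof -
  let ?B = "fiber_bound f g" and ?l = "shift_pivot f g v u"
  note fin = finite_supp[OF f] finite_supp[OF g]
  have "finite (snd ` (supp f \<union> supp g))" using fin by simp
  then obtain D where "\<forall>k\<in>snd ` (supp f \<union> supp g). k \<le> D"
    unfolding finite_nat_set_iff_bounded_le by blast
  then have D: "f (x, k) = Infty" "g (x, k) = Infty" if "D < k" for x k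
    using that by (force simp: supp_def)+
  define L' where "L' = {h \<in> L. \<forall>x\<in>{u} \<times> {2 * D<..}. h x = Infty}"
  have "\<exists>h\<in>L'. (\<forall>x\<in>{u} \<times> {..2 * D}. h x = Infty) \<and> (\<forall>x. ?B x \<le> h x) \<and>
      (\<exists>j\<in>UNIV \<times> {..D}. h (?l j) = ?B (?l j))"
  proof (rule echelon_eliminate[where w = "shift_family f g"])
    show "card ({u} \<times> {..2 * D}) < card ((UNIV :: bool set) \<times> {..D})"
      by (simp add: card_cartesian_product)
    show "tropical_linear_space L'"
      unfolding L'_def using linear_space by (rule tropical_linear_space_vanishing)
    fix j :: "bool \<times> nat" assume "j \<in> UNIV \<times> {..D}"
    then have "shift_family f g j \<in> L'"
      using f g shift_closed by (auto simp: L'_def shift_family_def shift_def D)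
    moreover have "echelon_row ?B ?l (UNIV \<times> {..D}) j (shift_family f g j)"
      using fin u v by (rule echelon_row_shift_family)
    ultimately show "shift_family f g j \<in> L' \<and>
        echelon_row ?B ?l (UNIV \<times> {..D}) j (shift_family f g j)" ..
  qed auto
  then obtain h j where h: "h \<in> L'" "\<And>k. k \<le> 2 * D \<Longrightarrow> h (u, k) = Infty"
    "\<And>x. ?B x \<le> h x" "h (?l j) = ?B (?l j)"
    by auto
  then have in_L: "h \<in> L" and hu: "h (u, k) = Infty" for k
    unfolding L'_def by (cases "k \<le> 2 * D"; simp)+
  from in_L hu h(3,4) show thesis by (rule that)
qed

lemma eliminate_fiber:
  assumes f: "f \<in> L" and g: "g \<in> L"
    and u: "fiber_min f u = fiber_min g u" "fiber_min f u \<noteq> Infty"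
    and v: "fiber_min f v < fiber_min g v"
  shows "\<exists>h\<in>L. eliminates {v} u (fiber_min f) (fiber_min g) (fiber_min h)"
proof -
  obtain h j where "h \<in> L" and hu: "\<And>k. h (u, k) = Infty"
    and bound: "\<And>x. fiber_bound f g x \<le> h x"
    and pivot: "h (shift_pivot f g v u j) = fiber_bound f g (shift_pivot f g v u j)"
    using assms by (rule eliminate_in_shift_family) (rule that)
  obtain b i where j: "j = (b, i)" by (cases j)
  note fin = finite_supp[OF \<open>h \<in> L\<close>]
  have ge: "min (fiber_min f x) (fiber_min g x) \<le> fiber_min h x" for x
    using bound[of "(x, _)"] by (simp add: le_fiber_min_iff[OF fin] fiber_bound_def)
  have "\<not> b"
    using pivot hu u by (auto simp: j shift_pivot_def fiber_bound_def)
  then have "fiber_min h v \<le> fiber_min f v"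
    using pivot v fiber_min_le[OF fin, of v "least_minimizer f v + i"]
    by (simp add: j shift_pivot_def fiber_bound_def)
  with v ge[of v] have "fiber_min h v = min (fiber_min f v) (fiber_min g v)"
    by simp
  moreover have "fiber_min h u = Infty"
    using hu by (simp add: fiber_min_def)
  ultimately have "eliminates {v} u (fiber_min f) (fiber_min g) (fiber_min h)"
    using ge by (simp add: eliminates_def)
  with \<open>h \<in> L\<close> show ?thesis by blast
qed

lemma tropical_linear_space_fiber_min: "tropical_linear_space (fiber_min ` L)"
proof (rule tropical_linear_spaceI)
  show "tsubmodule (fiber_min ` L)"
    using linear_space finite_supp
    by (intro tsubmodule_image) (auto simp: tropical_linear_space_def fiber_min_add fiber_min_scale)
  show "finite (supp F)" if "F \<in> fiber_min ` L" for F
    using that finite_supp finite_supp_fiber_min by blast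
qed (use eliminate_fiber in blast)

end

section \<open>Multiplication of tropical polynomials\<close>

lemma is_tpoly_iff: "is_tpoly n f \<longleftrightarrow> finite (supp f) \<and> (\<forall>u\<in>supp f. length u = n)"
  by (simp add: is_tpoly_def supp_def)

lemma tpoly_eq_Infty: "is_tpoly n f \<Longrightarrow> length u \<noteq> n \<Longrightarrow> f u = Infty"
  by (auto simp: is_tpoly_def)

definition exponent_splits :: "nat list \<Rightarrow> (nat list \<times> nat list) set" where
  "exponent_splits w =
     {(u, v). length u = length w \<and> length v = length w \<and> map2 (+) u v = w}"

lemma exponent_splits_snoc:
  "exponent_splits (w @ [k]) =
    (\<lambda>((u, v), i, j). (u @ [i], v @ [j])) ` (exponent_splits w \<times> {(i, j). i + j = k})"
  (is "?l = ?r")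
proof
  show "?l \<subseteq> ?r"
  proof
    fix p assume p: "p \<in> ?l"
    then obtain u i v j where snoc: "p = (u @ [i], v @ [j])"
      unfolding exponent_splits_def by (clarsimp simp: length_Suc_conv_rev)
    with p have "((u, v), i, j) \<in> exponent_splits w \<times> {(i, j). i + j = k}"
      by (auto simp: exponent_splits_def)
    then show "p \<in> ?r"
      by (rule rev_image_eqI) (simp add: snoc)
  qed
  show "?r \<subseteq> ?l"
    by (simp add: exponent_splits_def image_subset_iff)
qed

lemma finite_exponent_splits: "finite (exponent_splits w)"
proof (induction w rule: rev_induct)
  case Nil
  have "exponent_splits [] = {([], [])}" by (auto simp: exponent_splits_def)
  then show ?case by simp
next
  case (snoc k w)
  have "finite {(i, j). i + j = k}"
    by (rule finite_subset[of _ "{..k} \<times> {..k}"]) auto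
  with snoc show ?case by (simp add: exponent_splits_snoc)
qed

lemma pmul_eq_sum: "pmul f g w = (\<Sum>(u, v)\<in>exponent_splits w. tmul (f u) (g v))"
proof -
  have "pmul f g w =
      (\<Sum>(u, v)\<in>{(u, v) \<in> exponent_splits w. f u \<noteq> Infty \<and> g v \<noteq> Infty}. tmul (f u) (g v))"
    by (simp add: pmul_def exponent_splits_def)
  also have "\<dots> = (\<Sum>(u, v)\<in>exponent_splits w. tmul (f u) (g v))"
    by (rule sum.mono_neutral_left[OF finite_exponent_splits]) (auto simp: zero_trop_def)
  finally show ?thesis .
qed

lemma le_pmul_iff: "c \<le> pmul f g w \<longleftrightarrow> (\<forall>(u, v)\<in>exponent_splits w. c \<le> tmul (f u) (g v))"
  unfolding pmul_eq_sum le_sum_trop_iff[OF finite_exponent_splits] by auto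

lemma pmul_scale_right: "pmul f (\<lambda>v. tmul c (g v)) w = tmul c (pmul f g w)"
  by (simp add: pmul_eq_sum tmul_sum_right[OF finite_exponent_splits] tmul.left_commute
      case_prod_unfold)

lemma supp_pmulE:
  assumes "w \<in> supp (pmul f g)"
  obtains u v where "(u, v) \<in> exponent_splits w" "u \<in> supp f" "v \<in> supp g"
proof -
  have "\<not> Infty \<le> pmul f g w" using assms by (simp add: supp_def)
  then show thesis using that unfolding le_pmul_iff by (auto simp: supp_def)
qed

lemma is_tpoly_pmul:
  assumes f: "is_tpoly n f" and g: "is_tpoly n g"
  shows "is_tpoly n (pmul f g)"
proof -
  have "supp (pmul f g) \<subseteq> (\<lambda>(u, v). map2 (+) u v) ` (supp f \<times> supp g)"
  proof
    fix w assume "w \<in> supp (pmul f g)"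
    then obtain u v where "(u, v) \<in> exponent_splits w" "(u, v) \<in> supp f \<times> supp g"
      by (blast elim: supp_pmulE)
    then show "w \<in> (\<lambda>(u, v). map2 (+) u v) ` (supp f \<times> supp g)"
      by (intro rev_image_eqI[of "(u, v)"]) (simp_all add: exponent_splits_def)
  qed
  then have "finite (supp (pmul f g))"
    using f g by (auto simp: is_tpoly_iff intro: finite_subset)
  moreover have "length w = n" if "w \<in> supp (pmul f g)" for w
    using that f by (elim supp_pmulE) (simp add: is_tpoly_iff exponent_splits_def)
  ultimately show ?thesis by (simp add: is_tpoly_iff)
qed

definition tmonom :: "trop \<Rightarrow> nat list \<Rightarrow> tpoly" where
  "tmonom c e = (\<lambda>u. if u = e then c else Infty)"

lemma is_tpoly_tmonom: "length e = n \<Longrightarrow> is_tpoly n (tmonom c e)"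
  unfolding is_tpoly_def tmonom_def by (auto intro: finite_subset[of _ "{e}"])

lemma map2_plus_left_cancel:
  fixes e v w :: "nat list"
  assumes "length e = length v" "length v = length w"
  shows "map2 (+) e v = map2 (+) e w \<longleftrightarrow> v = w"
  using assms by (induction e v w rule: list_induct3) auto

lemma map2_zeros_plus: "length w = n \<Longrightarrow> map2 (+) (replicate n 0) w = (w :: nat list)"
  by (induction w arbitrary: n) auto

lemma le_pmul_tmonom_iff:
  "b \<le> pmul (tmonom c e) f w \<longleftrightarrow> (\<forall>v. (e, v) \<in> exponent_splits w \<longrightarrow> b \<le> tmul c (f v))"
  by (auto simp: le_pmul_iff tmonom_def)

lemma pmul_tmonom_add:
  assumes "length e = length v"
  shows "pmul (tmonom c e) f (map2 (+) e v) = tmul c (f v)"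
proof (rule eqI_lower_bounds)
  have "(e, v') \<in> exponent_splits (map2 (+) e v) \<longleftrightarrow> v' = v" for v'
    using assms map2_plus_left_cancel[of e v' v] by (auto simp: exponent_splits_def)
  then show "b \<le> pmul (tmonom c e) f (map2 (+) e v) \<longleftrightarrow> b \<le> tmul c (f v)" for b
    by (simp add: le_pmul_tmonom_iff)
qed

lemma pmul_tmonom_eq_Infty:
  assumes "\<And>v. length v = length e \<Longrightarrow> map2 (+) e v \<noteq> w"
  shows "pmul (tmonom c e) f w = Infty"
proof -
  have "(e, v) \<notin> exponent_splits w" for v
    using assms[of v] by (simp add: exponent_splits_def)
  then have "Infty \<le> pmul (tmonom c e) f w"
    by (simp add: le_pmul_tmonom_iff)
  then show ?thesis by simp
qed

lemma pmul_const:
  assumes "is_tpoly n f"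
  shows "pmul (tmonom c (replicate n 0)) f = (\<lambda>w. tmul c (f w))"
proof
  fix w
  show "pmul (tmonom c (replicate n 0)) f w = tmul c (f w)"
  proof (cases "length w = n")
    case True
    then show ?thesis
      using pmul_tmonom_add[of "replicate n 0" w] by (simp add: map2_zeros_plus)
  next
    case False
    then have "map2 (+) (replicate n 0) v \<noteq> w" if "length v = n" for v
      using that by (auto simp: map2_zeros_plus)
    then have "pmul (tmonom c (replicate n 0)) f w = Infty"
      by (intro pmul_tmonom_eq_Infty) simp
    with False show ?thesis using tpoly_eq_Infty[OF assms] by simp
  qed
qed

lemma pmul_last_power_snoc:
  assumes "is_tpoly (Suc n) f"
  shows "pmul (tmonom c (replicate n 0 @ [i])) f (w @ [k]) =
    (if i \<le> k then tmul c (f (w @ [k - i])) else Infty)"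
proof (cases "length w = n \<and> i \<le> k")
  case True
  then show ?thesis
    using pmul_tmonom_add[of "replicate n 0 @ [i]" "w @ [k - i]"] by (simp add: map2_zeros_plus)
next
  case False
  have "map2 (+) (replicate n 0 @ [i]) v \<noteq> w @ [k]" if "length v = Suc n" for v
    using that False by (cases v rule: rev_cases) (auto simp: map2_zeros_plus)
  then have "pmul (tmonom c (replicate n 0 @ [i])) f (w @ [k]) = Infty"
    by (intro pmul_tmonom_eq_Infty) simp
  with False show ?thesis using tpoly_eq_Infty[OF assms] by auto
qed

section \<open>Substitution for the last variable\<close>

definition last_terms :: "trop \<Rightarrow> tpoly \<Rightarrow> nat list \<times> nat \<Rightarrow> trop" where
  "last_terms a f = (\<lambda>(w, k). tmul (tpow a k) (f (w @ [k])))"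

lemma finite_supp_last_terms:
  assumes "finite (supp f)"
  shows "finite (supp (last_terms a f))"
proof (rule finite_subset)
  show "supp (last_terms a f) \<subseteq> (\<lambda>(w, k). w @ [k]) -` supp f"
    by (auto simp: supp_def last_terms_def)
  show "finite ((\<lambda>(w, k). w @ [k]) -` supp f)"
    using assms by (rule finite_vimageI) (auto simp: inj_def)
qed

lemma subst_last_eq_fiber_min:
  assumes "finite (supp f)"
  shows "subst_last a f = fiber_min (last_terms a f)"
proof (rule ext, rule eqI_lower_bounds)
  fix w c
  have "finite ((\<lambda>k. w @ [k]) -` supp f)"
    using assms by (rule finite_vimageI) (auto simp: inj_def)
  then have "finite {k. f (w @ [k]) \<noteq> Infty}" by (simp add: supp_def vimage_def)
  then have "c \<le> subst_last a f w \<longleftrightarrow>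
      (\<forall>k. f (w @ [k]) \<noteq> Infty \<longrightarrow> c \<le> tmul (f (w @ [k])) (tpow a k))"
    by (simp add: subst_last_def le_sum_trop_iff)
  also have "\<dots> \<longleftrightarrow> (\<forall>k. c \<le> last_terms a f (w, k))"
    by (auto simp: last_terms_def tmul.commute) (metis le_Infty tmul_Infty(1))
  finally show "c \<le> subst_last a f w \<longleftrightarrow> c \<le> fiber_min (last_terms a f) w"
    by (simp add: le_fiber_min_iff finite_supp_last_terms assms)
qed

lemma le_tmul_subst_last_iff:
  assumes "finite (supp f)"
  shows "c \<le> tmul b (subst_last a f w) \<longleftrightarrow> (\<forall>k. c \<le> tmul b (tmul (tpow a k) (f (w @ [k]))))"
proof -
  note fin = finite_supp_last_terms[OF assms, of a]
  have "tmul b (subst_last a f w) = fiber_min (\<lambda>x. tmul b (last_terms a f x)) w"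
    by (simp add: subst_last_eq_fiber_min[OF assms] fiber_min_scale[OF fin])
  then show ?thesis
    by (simp only: le_fiber_min_iff[OF finite_supp_scale[OF fin]]) (simp add: last_terms_def)
qed

lemma le_subst_last_iff:
  assumes "finite (supp f)"
  shows "c \<le> subst_last a f w \<longleftrightarrow> (\<forall>k. c \<le> tmul (tpow a k) (f (w @ [k])))"
  using le_tmul_subst_last_iff[OF assms, of c "Fin 0"] by simp

lemma subst_last_Infty:
  assumes "finite (supp f)"
  shows "subst_last Infty f = (\<lambda>w. f (w @ [0]))"
proof (rule ext, rule eqI_lower_bounds)
  fix w c
  have "tmul (tpow Infty k) x = (if k = 0 then x else Infty)" for k x
    by (cases k) auto
  then show "c \<le> subst_last Infty f w \<longleftrightarrow> c \<le> f (w @ [0])"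
    by (simp add: le_subst_last_iff[OF assms])
qed

lemma is_tpoly_subst_last:
  assumes "is_tpoly (Suc n) f"
  shows "is_tpoly n (subst_last a f)"
proof -
  have fin: "finite (supp f)" using assms by (simp add: is_tpoly_iff)
  have "subst_last a f w = Infty" if "length w \<noteq> n" for w
    using le_subst_last_iff[OF fin, of Infty] that tpoly_eq_Infty[OF assms] by simp
  then show ?thesis
    using finite_supp_fiber_min[OF finite_supp_last_terms[OF fin]]
    by (auto simp: is_tpoly_iff subst_last_eq_fiber_min[OF fin] supp_def)
qed

definition const_in_last :: "tpoly \<Rightarrow> tpoly" where
  "const_in_last h = (\<lambda>u. if u \<noteq> [] \<and> last u = 0 then h (butlast u) else Infty)"

lemma is_tpoly_const_in_last:
  assumes "is_tpoly n h"
  shows "is_tpoly (Suc n) (const_in_last h)"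
proof -
  have "supp (const_in_last h) = (\<lambda>w. w @ [0]) ` supp h"
  proof
    show "supp (const_in_last h) \<subseteq> (\<lambda>w. w @ [0]) ` supp h"
    proof
      fix u assume "u \<in> supp (const_in_last h)"
      then show "u \<in> (\<lambda>w. w @ [0]) ` supp h"
        by (cases u rule: rev_cases) (auto simp: supp_def const_in_last_def split: if_splits)
    qed
  qed (auto simp: supp_def const_in_last_def)
  then show ?thesis using assms by (auto simp: is_tpoly_iff)
qed

lemma pmul_const_in_last_snoc:
  "pmul (const_in_last h) f (w @ [k]) = pmul h (\<lambda>v. f (v @ [k])) w"
proof (rule eqI_lower_bounds)
  fix c
  have "c \<le> pmul (const_in_last h) f (w @ [k]) \<longleftrightarrow> (\<forall>u v i j. (u, v) \<in> exponent_splits w \<and>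
      i + j = k \<longrightarrow> c \<le> tmul (const_in_last h (u @ [i])) (f (v @ [j])))"
    unfolding le_pmul_iff exponent_splits_snoc by fastforce
  also have "\<dots> \<longleftrightarrow> c \<le> pmul h (\<lambda>v. f (v @ [k])) w"
    by (auto simp: le_pmul_iff const_in_last_def)
  finally show "c \<le> pmul (const_in_last h) f (w @ [k]) \<longleftrightarrow> c \<le> pmul h (\<lambda>v. f (v @ [k])) w" .
qed

lemma subst_last_pmul_const_in_last:
  assumes "is_tpoly n h" "is_tpoly (Suc n) f"
  shows "subst_last a (pmul (const_in_last h) f) = pmul h (subst_last a f)"
proof (rule ext, rule eqI_lower_bounds)
  fix w c
  have fin: "finite (supp f)" "finite (supp (pmul (const_in_last h) f))"
    using assms(2) is_tpoly_pmul[OF is_tpoly_const_in_last[OF assms(1)] assms(2)]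
    by (simp_all add: is_tpoly_iff)
  have "c \<le> subst_last a (pmul (const_in_last h) f) w \<longleftrightarrow>
      (\<forall>k. c \<le> pmul h (\<lambda>v. tmul (tpow a k) (f (v @ [k]))) w)"
    by (simp add: le_subst_last_iff[OF fin(2)] pmul_const_in_last_snoc pmul_scale_right)
  also have "\<dots> \<longleftrightarrow> (\<forall>(u, v)\<in>exponent_splits w. c \<le> tmul (h u) (subst_last a f v))"
    by (auto simp: le_pmul_iff le_tmul_subst_last_iff[OF fin(1)])
  also have "\<dots> \<longleftrightarrow> c \<le> pmul h (subst_last a f) w"
    by (simp add: le_pmul_iff)
  finally show "c \<le> subst_last a (pmul (const_in_last h) f) w \<longleftrightarrow> c \<le> pmul h (subst_last a f) w" .
qed

section \<open>Tropical ideals\<close>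

lemma tideal_is_tpoly: "tideal n I \<Longrightarrow> f \<in> I \<Longrightarrow> is_tpoly n f"
  by (auto simp: tideal_def)

lemma tideal_pmul: "tideal n I \<Longrightarrow> f \<in> I \<Longrightarrow> is_tpoly n h \<Longrightarrow> pmul h f \<in> I"
  by (simp add: tideal_def)

lemma tideal_iff_tsubmodule:
  "tideal n I \<longleftrightarrow> tsubmodule I \<and> (\<forall>f\<in>I. is_tpoly n f) \<and>
     (\<forall>f\<in>I. \<forall>h. is_tpoly n h \<longrightarrow> pmul h f \<in> I)"
proof -
  have "(\<lambda>w. tmul c (f w)) \<in> I" if "tideal n I" "f \<in> I" for f c
    using tideal_pmul[OF that is_tpoly_tmonom[of "replicate n 0" n c]] tideal_is_tpoly[OF that]
    by (simp add: pmul_const)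
  then show ?thesis
    by (auto simp: tideal_def tsubmodule_def padd_def)
qed

lemma tropical_ideal_iff:
  "tropical_ideal n I \<longleftrightarrow> tideal n I \<and> tropical_linear_space I"
  unfolding tropical_ideal_def tropical_linear_space_def Bex_def eliminates_differing_iff
    tideal_iff_tsubmodule
  by (intro iffI conjI; elim conjE; assumption)

text \<open>The factor is the \<open>i\<close>-th power of \<open>x / a\<close> for the last variable \<open>x\<close>, which takes the value
  \<open>0\<close>, the tropical one, at \<open>x = a\<close>.\<close>

lemma shift_last_terms:
  assumes "is_tpoly (Suc n) f"
  shows "shift i (last_terms (Fin a) f) =
    last_terms (Fin a) (pmul (tmonom (Fin (- (real i * a))) (replicate n 0 @ [i])) f)"
proof
  fix x
  show "shift i (last_terms (Fin a) f) x =
    last_terms (Fin a) (pmul (tmonom (Fin (- (real i * a))) (replicate n 0 @ [i])) f) x"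
    by (cases x) (auto simp: shift_def last_terms_def pmul_last_power_snoc[OF assms] algebra_simps
        tmul.assoc[symmetric])
qed

lemma shift_closed_linear_space_last_terms:
  assumes "tropical_ideal (Suc n) I"
  shows "shift_closed_linear_space (last_terms (Fin a) ` I)"
proof
  have tideal: "tideal (Suc n) I" and "tropical_linear_space I"
    using assms by (simp_all add: tropical_ideal_iff)
  have "last_terms (Fin a) = (\<lambda>f x. tmul (Fin (real (snd x) * a)) (f (fst x @ [snd x])))"
    by (simp add: last_terms_def fun_eq_iff)
  then show "tropical_linear_space (last_terms (Fin a) ` I)"
    using tropical_linear_space_reweight[OF \<open>tropical_linear_space I\<close>] by simp
  show "finite (supp f)" if "f \<in> last_terms (Fin a) ` I" for f
    using that tideal_is_tpoly[OF tideal] finite_supp_last_terms by (auto simp: is_tpoly_iff)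
  show "shift i f \<in> last_terms (Fin a) ` I" if "f \<in> last_terms (Fin a) ` I" for f i
  proof -
    from that obtain g where g: "g \<in> I" "f = last_terms (Fin a) g" by blast
    have "pmul (tmonom (Fin (- (real i * a))) (replicate n 0 @ [i])) g \<in> I"
      using tideal_pmul[OF tideal g(1)] by (simp add: is_tpoly_tmonom)
    then show ?thesis
      using shift_last_terms[OF tideal_is_tpoly[OF tideal g(1)]] g(2) by auto
  qed
qed

lemma tropical_linear_space_subst_last:
  assumes I: "tropical_ideal (Suc n) I"
  shows "tropical_linear_space (subst_last a ` I)"
proof -
  have fin: "finite (supp f)" if "f \<in> I" for f
    using I that by (simp add: tropical_ideal_iff tideal_iff_tsubmodule is_tpoly_iff)
  show ?thesis
  proof (cases a)
    case (Fin r)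
    interpret shift_closed_linear_space "last_terms (Fin r) ` I"
      using I by (rule shift_closed_linear_space_last_terms)
    have "subst_last a ` I = fiber_min ` last_terms (Fin r) ` I"
      unfolding image_image using fin Fin subst_last_eq_fiber_min by (intro image_cong) auto
    with tropical_linear_space_fiber_min show ?thesis by simp
  next
    case Infty
    have "subst_last a ` I = (\<lambda>f w. tmul (Fin 0) (f (w @ [0]))) ` I"
      using fin Infty subst_last_Infty by (intro image_cong) auto
    with I show ?thesis
      by (simp only: tropical_ideal_iff tropical_linear_space_reweight)
  qed
qed

theorem theorem3p3:
  fixes n :: nat and I :: "tpoly set" and a :: trop
  assumes "n \<ge> 1" and "tropical_ideal n I"
  shows "tropical_ideal (n - 1) (subst_last a ` I)"
proof -
  obtain m where n: "n = Suc m" using assms(1) by (cases n) auto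
  with assms(2) have I: "tropical_ideal (Suc m) I" by simp
  then have tideal: "tideal (Suc m) I" by (simp add: tropical_ideal_iff)
  have linear_space: "tropical_linear_space (subst_last a ` I)"
    using I by (rule tropical_linear_space_subst_last)
  have "pmul h (subst_last a f) \<in> subst_last a ` I" if "f \<in> I" "is_tpoly m h" for f h
    using subst_last_pmul_const_in_last[OF that(2) tideal_is_tpoly[OF tideal that(1)], of a]
      tideal_pmul[OF tideal that(1) is_tpoly_const_in_last[OF that(2)]] by (metis image_eqI)
  with linear_space have "tideal m (subst_last a ` I)"
    using tideal_is_tpoly[OF tideal] is_tpoly_subst_last
    by (auto simp: tideal_iff_tsubmodule tropical_linear_space_def)
  with linear_space n show ?thesis by (simp add: tropical_ideal_iff)
qed

end
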